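(* Consider two regular polygons with $n$ sides, of distinct sizes, centered at a point $C$, whose sides are partitioned into $4$ segments by points such that $2n$ segments passing through $C$ and cutting the larger polygon meet the sides of the polygons at these points. Let $P_{t,m}$ be the points on the $t$-th polygon, as described in the context, and suppose that: (i) each point $P_{t,4(i-1)+j}$ is labeled by some $x_{t,4(i-1)+j}\in\{1,2,\dots,8n+1\}$; (ii) the central point $C$ is labeled by $c=4n+1$; (iii) $x_{1,4(i-1)+j}+x_{2,4(i-1)+j}=2(4n+1)$; (iv) $x_{t,4(i_1-1)+j_1}+x_{t,4(i_2-1)+j_2}\neq 2(4n+1)$ if $(i_1,j_1)\neq(i_2,j_2)$; (v) $x_{1,4(i-1)+1}+x_{1,4(i-1)+2}+x_{1,4(i-1)+3}+x_{1,4(i-1)+4}+x_{1,4(i-1)+5}=5(4n+1)$; where these hold for all $t\in\{1,2\}$, all $i,i_1,i_2\in\{1,\dots,n\}$ and all $j,j_1,j_2\in\{1,2,3,4\}$. Then the resulting $8n+1$ points define a magic polygon $P(n,4)$.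
   Context: Indexing: the boundary of the $t$-th polygon ($t\in\{1,2\}$) carries $4n$ points $P_{t,m}$, listed in cyclic order with $m$ taken modulo $4n$; $P_{t,4(i-1)+j}$ is the $j$-th point of the $i$-th edge, the vertices are the points with $j=1$, and the $i$-th edge contains the five points $P_{t,4(i-1)+1},\dots,P_{t,4(i-1)+5}$. The label of $P_{t,m}$ is $x_{t,m}$. Each of the $2n$ segments through $C$ contains the five points $P_{1,m},P_{2,m},C,P_{1,m+2n},P_{2,m+2n}$ for some $m$. Magic polygon $P(n,4)$: take two regular $n$-gons of different sizes with corresponding sides parallel and a common center $C$. A magic polygon $P(n,4)$ is a set of $8n+1$ points, labeled by distinct values from $1$ to $8n+1$, consisting of $C$, the $2n$ vertices of the two polygons, and $3$ intermediate points on each edge of each polygon, such that each segment through $C$ with diametrically opposite ends on the larger polygon contains $5$ of the points, each segment joining two adjacent vertices of one of the polygons contains $5$ of the points, and the sum of the labels of the $5$ points on each of these segments is a fixed value $u$ (the magic sum).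
   Formalization: It is additionally assumed that the labels on each polygon are pairwise distinct and differ from the central label 4n+1; without this, (i)–(v) allow repeated labels (e.g. n=3, edges 15,15,10,10,15 and 11,11,16,16,11) and the claim fails. *)

theory Defs
  imports "HOL-Analysis.Analysis"
begin

text \<open>
  The plane is \<^typ>\<open>complex\<close>. A polygon is given by its vertices \<^term>\<open>v 0\<close>, \<^term>\<open>v 1\<close>, \dots in
  cyclic order, continued periodically; both orientations are allowed.
\<close>

definition regular_polygon :: "nat \<Rightarrow> complex \<Rightarrow> (nat \<Rightarrow> complex) \<Rightarrow> bool" where
  "regular_polygon n C v \<longleftrightarrow> n \<ge> 3 \<and>
     (\<exists>a w. a \<noteq> 0 \<and> w \<in> {cis (2 * pi / real n), cis (- (2 * pi / real n))} \<and>
       (\<forall>i. v i = C + a * w ^ i))"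

definition polygon_boundary :: "nat \<Rightarrow> (nat \<Rightarrow> complex) \<Rightarrow> complex set" where
  "polygon_boundary n v = (\<Union>i<n. closed_segment (v i) (v (i + 1)))"

text \<open>
  The two polygons are \<^term>\<open>v 1\<close> and \<^term>\<open>v 2\<close>. Either of them may be the larger one. The factor
  \<^term>\<open>k\<close> is positive because corresponding sides lie on the same side of the centre, so that they
  are traversed in the same direction.
\<close>

definition polygon_pair :: "nat \<Rightarrow> complex \<Rightarrow> (nat \<Rightarrow> nat \<Rightarrow> complex) \<Rightarrow> bool" where
  "polygon_pair n C v \<longleftrightarrow>
     regular_polygon n C (v 1) \<and> regular_polygon n C (v 2) \<and>
     dist C (v 1 0) \<noteq> dist C (v 2 0) \<and>
     (\<forall>i. \<exists>k::real. k > 0 \<and> v 2 (i + 1) - v 2 i = k *\<^sub>R (v 1 (i + 1) - v 1 i))"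

definition larger :: "complex \<Rightarrow> (nat \<Rightarrow> nat \<Rightarrow> complex) \<Rightarrow> nat" where
  "larger C v = (if dist C (v 1 0) > dist C (v 2 0) then 1 else 2)"

text \<open>
  \<^term>\<open>P t m\<close> is the \<^term>\<open>m\<close>-th point on polygon \<^term>\<open>t\<close>, with \<^term>\<open>m\<close> taken modulo \<^term>\<open>4 * n\<close>.
  Edges are counted from 1 and vertices \<^term>\<open>v t i\<close> from 0, so the \<^term>\<open>i\<close>-th edge runs from
  \<^term>\<open>v t (i - 1)\<close> to \<^term>\<open>v t i\<close>. The position of the intermediate points on an edge is
  constrained only by their order and by the segments through \<^term>\<open>C\<close>.
\<close>

definition polygon_points ::
    "nat \<Rightarrow> complex \<Rightarrow> (nat \<Rightarrow> nat \<Rightarrow> complex) \<Rightarrow> (nat \<Rightarrow> nat \<Rightarrow> complex) \<Rightarrow> bool" where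
  "polygon_points n C v P \<longleftrightarrow>
     (\<forall>t\<in>{1, 2}. \<forall>m. P t (m + 4 * n) = P t m) \<and>
     (\<forall>t\<in>{1, 2}. \<forall>i\<in>{1..n}. P t (4 * (i - 1) + 1) = v t (i - 1)) \<and>
     (\<forall>t\<in>{1, 2}. \<forall>i\<in>{1..n}. \<forall>j\<in>{1, 2, 3}.
        P t (4 * (i - 1) + j + 1)
          \<in> open_segment (P t (4 * (i - 1) + j)) (P t (4 * (i - 1) + 5))) \<and>
     (\<forall>m. {P 1 m, P 2 m, C, P 1 (m + 2 * n), P 2 (m + 2 * n)}
        \<subseteq> closed_segment (P (larger C v) m) (P (larger C v) (m + 2 * n)))"

text \<open>
  \<^term>\<open>magic_polygon4 n C v S label\<close>: the set \<^term>\<open>S\<close> of points with labels \<^term>\<open>label\<close> is a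
  magic polygon P(n,4) on the polygons \<^term>\<open>v 1\<close>, \<^term>\<open>v 2\<close>. Among the infinitely many chords
  of the larger polygon through \<^term>\<open>C\<close>, only those with an end \<^term>\<open>p\<close> in \<^term>\<open>S\<close> are meant; the
  opposite end \<^term>\<open>q\<close> is just a point of the boundary, and it is the count that puts it in \<^term>\<open>S\<close>.
\<close>

definition magic_polygon4 ::
    "nat \<Rightarrow> complex \<Rightarrow> (nat \<Rightarrow> nat \<Rightarrow> complex) \<Rightarrow> complex set \<Rightarrow> (complex \<Rightarrow> nat) \<Rightarrow> bool" where
  "magic_polygon4 n C v S label \<longleftrightarrow>
     polygon_pair n C v \<and>
     card S = 8 * n + 1 \<and>
     bij_betw label S {1..8 * n + 1} \<and>
     C \<in> S \<and>
     (\<forall>t\<in>{1, 2}. \<forall>i<n. v t i \<in> S) \<and>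
     (\<forall>t\<in>{1, 2}. \<forall>i<n. card (S \<inter> open_segment (v t i) (v t (i + 1))) = 3) \<and>
     S \<subseteq> {C} \<union> polygon_boundary n (v 1) \<union> polygon_boundary n (v 2) \<and>
     (\<exists>u.
       (\<forall>p \<in> S \<inter> polygon_boundary n (v (larger C v)).
          \<forall>q \<in> polygon_boundary n (v (larger C v)).
            C \<in> closed_segment p q \<longrightarrow>
              card (S \<inter> closed_segment p q) = 5 \<and>
              (\<Sum>z \<in> S \<inter> closed_segment p q. label z) = u) \<and>
       (\<forall>t\<in>{1, 2}. \<forall>i<n.
          card (S \<inter> closed_segment (v t i) (v t (i + 1))) = 5 \<and>
          (\<Sum>z \<in> S \<inter> closed_segment (v t i) (v t (i + 1)). label z) = u))"

end

theory Submission
  imports Defs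
begin

text \<open>
  The labels on the two points \<open>P 1 m\<close>, \<open>P 2 m\<close> add up to twice the label of the
  centre. A spoke through the centre carries two such pairs and the centre itself, so its sum is
  five times the label of the centre. An edge of the first polygon has this sum by
  hypothesis; taking the corresponding edge of the second polygon, the ten labels on
  both add up to ten times the label of the centre, so the second edge has the same sum. The labels
  are pairwise distinct: two points on the same polygon differ by hypothesis, and if \<open>P 1 m\<close> had the
  label of \<open>P 2 m'\<close>, then the labels of \<open>P 1 m\<close> and \<open>P 1 m'\<close> would be complementary, which is
  excluded for different positions and gives the label of the centre for equal ones
  (\<open>label_cross_distinct\<close>). Counting, the labels are all the numbers from 1 to \<open>8 * n + 1\<close>.

  What remains is geometry: an edge, or a chord through the centre that starts at a marked point,
  must contain the five intended points and no further ones. All of this is read off from the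
  linear functional \<open>edge_height\<close> of an edge, which is 0 at the centre, 1 on that edge, at most 1 on
  the whole boundary and less than 1 at the vertices off that edge. It gives two facts:

  \<^item> A ray from the centre meets the boundary at most once (\<open>boundary_meets_ray_once\<close>). Hence a
    chord through the centre meets each boundary at most twice, and its two ends determine each
    other. Since the two polygons are homothetic with ratio different from 1, also their boundaries
    are disjoint.

  \<^item> Different edges of one polygon share at most a vertex (\<open>edge_meets_edge\<close>).

  Every marked point lies on the boundary of its own polygon, so these facts determine the marked
  points on each edge (\<open>marks_on_edge\<close>) and on each chord (\<open>marks_on_chord\<close>).
\<close>

section \<open>Support functionals of a regular polygon\<close>

text \<open>
  The foot of the perpendicular from the centre to an edge of a regular polygon is the midpoint of
  that edge. The height of \<open>z\<close> over the centre, measured perpendicularly to the edge, is divided by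
  the apothem, so that edges of polygons of all sizes have height 1.
\<close>

definition edge_height :: "complex \<Rightarrow> (nat \<Rightarrow> complex) \<Rightarrow> nat \<Rightarrow> complex \<Rightarrow> real" where
  "edge_height C v i z =
     (z - C) \<bullet> (midpoint (v i) (v (i + 1)) - C)
       / (norm (midpoint (v i) (v (i + 1)) - C))\<^sup>2"

lemma edge_height_convex:
  "edge_height C v i ((1 - u) *\<^sub>R y + u *\<^sub>R z)
     = (1 - u) * edge_height C v i y + u * edge_height C v i z"
proof -
  have "(1 - u) *\<^sub>R y + u *\<^sub>R z - C = (1 - u) *\<^sub>R (y - C) + u *\<^sub>R (z - C)"
    by (simp add: algebra_simps)
  then show ?thesis
    by (simp add: edge_height_def inner_add_left inner_scaleR_left add_divide_distrib)
qed

lemma edge_height_scale: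
  "y - C = s *\<^sub>R (z - C) \<Longrightarrow> edge_height C v i y = s * edge_height C v i z"
  by (simp add: edge_height_def)

lemma cos_le_cos_between:
  fixes \<theta> y :: real
  assumes "0 \<le> \<theta>" "\<theta> \<le> y" "y \<le> 2 * pi - \<theta>"
  shows "cos y \<le> cos \<theta>"
proof (cases "y \<le> pi")
  case True
  then show ?thesis using assms by (intro cos_monotone_0_pi_le) auto
next
  case False
  have "cos (2 * pi - y) \<le> cos \<theta>"
    using assms False by (intro cos_monotone_0_pi_le) auto
  then show ?thesis by (simp add: cos_diff)
qed

lemma cos_less_1_between:
  fixes y :: real
  assumes "0 < y" "y < 2 * pi"
  shows "cos y < 1"
proof -
  let ?m = "min y (2 * pi - y)"
  have "cos y \<le> cos ?m" using assms by (intro cos_le_cos_between) auto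
  also have "\<dots> < cos 0" using assms by (intro cos_monotone_0_pi) auto
  finally show ?thesis by simp
qed

lemma regular_polygon_periodic:
  assumes "regular_polygon n C v"
  shows "v (i + n) = v i"
proof -
  obtain a w where w: "w \<in> {cis (2 * pi / real n), cis (- (2 * pi / real n))}"
    and v: "\<And>i. v i = C + a * w ^ i" and n: "n \<ge> 3"
    using assms unfolding regular_polygon_def by blast
  have "real n * (2 * pi / real n) = 2 * pi" "real n * (- (2 * pi / real n)) = - (2 * pi)"
    using n by auto
  then have "w ^ n = cis (2 * pi) \<or> w ^ n = cis (- (2 * pi))"
    using w Complex.DeMoivre by (metis insertE singletonD)
  then have "w ^ n = 1" by (auto simp: complex_eq_iff)
  then show ?thesis by (simp add: v power_add)
qed

lemma regular_polygon_mod: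
  assumes "regular_polygon n C v"
  shows "v (i mod n) = v i"
proof -
  have "v (j + n * q) = v j" for j q
  proof (induction q)
    case (Suc q)
    then show ?case
      using regular_polygon_periodic[OF assms, of "j + n * q"] by (simp add: algebra_simps)
  qed simp
  from this[of "i mod n" "i div n"] show ?thesis by simp
qed

text \<open>
  The edge midpoint is the average of two vertices, so the inner product of a vertex with it is an
  average of two cosines of differences of polar angles. Cosine being even, the orientation of
  the polygon does not matter.
\<close>

lemma vertex_edge_height:
  assumes "regular_polygon n C v"
  shows "edge_height C v i (v (i + d))
    = (cos (real d * (2 * pi / real n)) + cos ((real d - 1) * (2 * pi / real n)))
        / (1 + cos (2 * pi / real n))"
proof -
  obtain a w where a: "a \<noteq> 0" and w: "w \<in> {cis (2 * pi / real n), cis (- (2 * pi / real n))}"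
    and v: "\<And>i. v i = C + a * w ^ i" and n: "n \<ge> 3"
    using assms unfolding regular_polygon_def by blast
  define \<theta> where "\<theta> = 2 * pi / real n"
  from w obtain \<phi> where \<phi>: "w = cis \<phi>" "\<phi> = \<theta> \<or> \<phi> = - \<theta>" unfolding \<theta>_def by blast
  let ?g = "(cmod a)\<^sup>2 / 2"
  let ?m = "midpoint (v i) (v (i + 1)) - C"
  have vertex: "v j - C = a * cis (real j * \<phi>)" for j
    using Complex.DeMoivre[of \<phi> j] by (simp add: v \<phi>(1))
  have mid: "?m = (1 / 2) *\<^sub>R ((v i - C) + (v (i + 1) - C))"
    by (simp add: midpoint_def algebra_simps scaleR_conv_of_real)
  have cos_inner: "(a * cis \<alpha>) \<bullet> (a * cis \<beta>) = (cmod a)\<^sup>2 * cos (\<alpha> - \<beta>)" for \<alpha> \<beta>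
    unfolding inner_complex_def cmod_power2 cos_diff by (simp, algebra)
  have inner: "(v (i + d) - C) \<bullet> ?m = ?g * (cos (real d * \<theta>) + cos ((real d - 1) * \<theta>))" for d
  proof -
    have "(v (i + d) - C) \<bullet> ?m = ?g * (cos (real d * \<phi>) + cos ((real d - 1) * \<phi>))"
      unfolding mid inner_scaleR_right inner_add_right vertex cos_inner
      by (simp add: algebra_simps)
    moreover have "cos (r * \<phi>) = cos (r * \<theta>)" for r using \<phi>(2) by auto
    ultimately show ?thesis by simp
  qed
  have "(norm ?m)\<^sup>2 = ((v (i + 0) - C) \<bullet> ?m + (v (i + 1) - C) \<bullet> ?m) / 2"
    unfolding power2_norm_eq_inner by (subst (1) mid) (simp only: inner_scaleR_left inner_add_left, simp)
  also have "\<dots> = ?g * (1 + cos \<theta>)" unfolding inner by simp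
  finally have "edge_height C v i (v (i + d))
      = ?g * (cos (real d * \<theta>) + cos ((real d - 1) * \<theta>)) / (?g * (1 + cos \<theta>))"
    by (simp only: edge_height_def inner)
  also have "\<dots> = (cos (real d * \<theta>) + cos ((real d - 1) * \<theta>)) / (1 + cos \<theta>)"
    using a by (intro mult_divide_mult_cancel_left) simp
  finally show ?thesis by (simp only: \<theta>_def)
qed

lemma one_plus_cos_step_pos:
  assumes "n \<ge> 3"
  shows "1 + cos (2 * pi / real n) > 0"
proof -
  have "cos pi < cos (2 * pi / real n)"
    using assms by (intro cos_monotone_0_pi) (auto simp: field_simps)
  then show ?thesis by simp
qed

lemma edge_height_on_edge:
  assumes "regular_polygon n C v" "z \<in> closed_segment (v i) (v (i + 1))"
  shows "edge_height C v i z = 1"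
proof -
  have "1 + cos (2 * pi / real n) \<noteq> 0"
    using one_plus_cos_step_pos[of n] assms(1) by (simp add: regular_polygon_def)
  then have "edge_height C v i (v i) = 1" "edge_height C v i (v (i + 1)) = 1"
    using vertex_edge_height[OF assms(1), of i 0] vertex_edge_height[OF assms(1), of i 1]
    by (simp_all add: add.commute)
  then show ?thesis
    using assms(2) by (auto simp: closed_segment_def edge_height_convex simp del: add_Suc_right)
qed

text \<open>
  For \<open>2 \<le> d < n\<close> the angles \<open>d * \<theta>\<close> and \<open>(d - 1) * \<theta>\<close>, where \<open>\<theta> = 2 * pi / n\<close>, stay at distance at
  least \<open>\<theta>\<close> from the multiples of \<open>2 * pi\<close>. So one cosine is at most \<open>cos \<theta>\<close> and the other one is less
  than 1, while the edge itself has \<open>1\<close> and \<open>cos \<theta>\<close>.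
\<close>

lemma edge_height_far_vertex:
  assumes "regular_polygon n C v" "2 \<le> d" "d < n"
  shows "edge_height C v i (v (i + d)) < 1"
proof -
  define \<theta> where "\<theta> = 2 * pi / real n"
  have \<theta>: "0 < \<theta>" "real n * \<theta> = 2 * pi" using assms by (auto simp: \<theta>_def)
  have le: "real d * \<theta> \<le> (real n - 1) * \<theta>"
    using assms \<theta> by (intro mult_right_mono) auto
  have ge: "2 * \<theta> \<le> real d * \<theta>" using assms \<theta> by (intro mult_right_mono) auto
  have "cos (real d * \<theta>) \<le> cos \<theta>"
    using le ge \<theta> by (intro cos_le_cos_between) (auto simp: algebra_simps)
  moreover have "cos ((real d - 1) * \<theta>) < 1"
    using le ge \<theta> by (intro cos_less_1_between) (auto simp: algebra_simps)
  moreover have "1 + cos \<theta> > 0"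
    using one_plus_cos_step_pos[of n] assms by (simp add: \<theta>_def)
  ultimately show ?thesis
    unfolding vertex_edge_height[OF assms(1)] \<theta>_def[symmetric] by (simp add: field_simps)
qed

lemma edge_height_vertex_le:
  assumes "regular_polygon n C v"
  shows "edge_height C v i (v j) \<le> 1"
proof -
  have n: "n \<ge> 3" using assms by (simp add: regular_polygon_def)
  \<comment> \<open>The residue of \<open>j - i\<close>, written without subtraction of indices.\<close>
  define d where "d = (j + (n - 1) * i) mod n"
  have "(i + d) mod n = (i + (j + (n - 1) * i)) mod n" by (simp add: d_def mod_add_right_eq)
  also have "i + (j + (n - 1) * i) = j + n * i" using n by (cases n) auto
  finally have "(i + d) mod n = j mod n" by simp
  then have "v j = v (i + d)" using regular_polygon_mod[OF assms] by metis
  moreover have "edge_height C v i (v (i + d)) \<le> 1"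
  proof -
    consider "d = 0" | "d = 1" | "2 \<le> d" by linarith
    then show ?thesis
    proof cases
      case 1
      then show ?thesis using edge_height_on_edge[OF assms, of "v i" i] by simp
    next
      case 2
      then show ?thesis using edge_height_on_edge[OF assms, of "v (i + 1)" i] by simp
    next
      case 3
      moreover have "d < n" using n by (simp add: d_def)
      ultimately show ?thesis using edge_height_far_vertex[OF assms, of d i] by simp
    qed
  qed
  ultimately show ?thesis by simp
qed

lemma edge_height_boundary_le:
  assumes "regular_polygon n C v" "z \<in> polygon_boundary n v"
  shows "edge_height C v i z \<le> 1"
proof -
  obtain j u where "z = (1 - u) *\<^sub>R v j + u *\<^sub>R v (j + 1)" "0 \<le> u" "u \<le> 1"
    using assms(2) unfolding polygon_boundary_def closed_segment_def by blast
  then show ?thesis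
    using convex_bound_le[of "edge_height C v i (v j)" 1 "edge_height C v i (v (j + 1))" "1 - u" u]
      edge_height_vertex_le[OF assms(1), of i] by (simp add: edge_height_convex)
qed

section \<open>Rays from the centre and the boundary\<close>

lemma edge_subset_boundary:
  assumes "regular_polygon n C v"
  shows "closed_segment (v i) (v (i + 1)) \<subseteq> polygon_boundary n v"
proof -
  have "i mod n < n" using assms by (simp add: regular_polygon_def)
  moreover have "v (i mod n) = v i" by (rule regular_polygon_mod[OF assms])
  moreover have "v (i mod n + 1) = v (i + 1)"
    using regular_polygon_mod[OF assms, of "i mod n + 1"] regular_polygon_mod[OF assms, of "i + 1"]
    by (simp add: mod_Suc_eq)
  moreover have "closed_segment (v (i mod n)) (v (i mod n + 1)) \<subseteq> polygon_boundary n v"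
    unfolding polygon_boundary_def using \<open>i mod n < n\<close> by blast
  ultimately show ?thesis by simp
qed

text \<open>
  Measured with the functional of the edge through \<open>y\<close>, the point \<open>y\<close> is at maximal height, so \<open>z\<close> is
  not higher; with the edge through \<open>z\<close> the roles are exchanged. Scaling by \<open>s\<close> scales heights by \<open>s\<close>.
\<close>

lemma boundary_meets_ray_once:
  assumes reg: "regular_polygon n C v"
    and "y \<in> polygon_boundary n v" "z \<in> polygon_boundary n v"
    and ray: "y - C = s *\<^sub>R (z - C)" "s > 0"
  shows "s = 1"
proof -
  obtain i j where "y \<in> closed_segment (v i) (v (i + 1))" "z \<in> closed_segment (v j) (v (j + 1))"
    using assms(2,3) unfolding polygon_boundary_def by blast
  then have "edge_height C v i y = 1" "edge_height C v j z = 1"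
    using edge_height_on_edge[OF reg] by auto
  moreover have "edge_height C v i z \<le> 1" "edge_height C v j y \<le> 1"
    using edge_height_boundary_le[OF reg] assms(2,3) by auto
  ultimately have "s * edge_height C v i z = 1" "edge_height C v i z \<le> 1" "s \<le> 1"
    using edge_height_scale[OF ray(1)] by auto
  then show ?thesis using ray(2) by (smt (verit) mult_left_le)
qed

lemma centre_notin_boundary:
  assumes "regular_polygon n C v"
  shows "C \<notin> polygon_boundary n v"
proof
  assume C: "C \<in> polygon_boundary n v"
  have "C - C = 2 *\<^sub>R (C - C)" by simp
  from boundary_meets_ray_once[OF assms C C this] show False by simp
qed

lemma between_centre_opposite:
  fixes C p q :: complex
  assumes "C \<in> closed_segment p q" "p \<noteq> C" "q \<noteq> C"
  obtains s where "s > 0" "q - C = - s *\<^sub>R (p - C)"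
proof -
  obtain u where u: "C = (1 - u) *\<^sub>R p + u *\<^sub>R q" "0 \<le> u" "u \<le> 1"
    using assms(1) by (auto simp: closed_segment_def)
  have "u \<noteq> 0" "u \<noteq> 1" using u assms by auto
  with u have u01: "0 < u" "u < 1" by auto
  have "u *\<^sub>R (q - C) = - (1 - u) *\<^sub>R (p - C)"
    using u(1) by (simp add: algebra_simps)
  then have "(1 / u) *\<^sub>R (u *\<^sub>R (q - C)) = (1 / u) *\<^sub>R (- (1 - u) *\<^sub>R (p - C))" by simp
  moreover have "(1 / u) * - (1 - u) = - ((1 - u) / u)" by (metis minus_mult_right mult.commute mult_1 times_divide_eq_left)
  ultimately have "q - C = - ((1 - u) / u) *\<^sub>R (p - C)"
    using u01 unfolding scaleR_scaleR by simp
  then show thesis using u01 by (intro that[of "(1 - u) / u"]) auto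
qed

lemma boundary_opposite_unique:
  assumes reg: "regular_polygon n C v"
    and bd: "p \<in> polygon_boundary n v" "q \<in> polygon_boundary n v" "q' \<in> polygon_boundary n v"
    and C: "C \<in> closed_segment p q" "C \<in> closed_segment p q'"
  shows "q = q'"
proof -
  have ne: "p \<noteq> C" "q \<noteq> C" "q' \<noteq> C" using bd centre_notin_boundary[OF reg] by auto
  obtain s where s: "s > 0" "q - C = - s *\<^sub>R (p - C)"
    using between_centre_opposite[OF C(1) ne(1,2)] .
  obtain s' where s': "s' > 0" "q' - C = - s' *\<^sub>R (p - C)"
    using between_centre_opposite[OF C(2) ne(1,3)] .
  have e: "q - C = (s / s') *\<^sub>R (q' - C)" using s s' by simp
  have "s / s' = 1" using boundary_meets_ray_once[OF reg bd(2,3) e] s s' by simp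
  with e show ?thesis by simp
qed

lemma chord_point_on_ray:
  fixes C p q z :: complex
  assumes "C \<in> closed_segment p q" "p \<noteq> C" "q \<noteq> C" "z \<in> closed_segment p q" "z \<noteq> C"
  obtains s r where "s > 0" "r \<in> {p, q}" "z - C = s *\<^sub>R (r - C)"
proof -
  obtain k where k: "k > 0" "q - C = - k *\<^sub>R (p - C)"
    using between_centre_opposite[OF assms(1-3)] .
  obtain u where u: "z = (1 - u) *\<^sub>R p + u *\<^sub>R q" "0 \<le> u" "u \<le> 1"
    using assms(4) by (auto simp: closed_segment_def)
  have "z - C = (1 - u) *\<^sub>R (p - C) + u *\<^sub>R (q - C)" using u(1) by (simp add: algebra_simps)
  also have "\<dots> = (1 - u - u * k) *\<^sub>R (p - C)" unfolding k(2) by (simp add: algebra_simps)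
  finally have z: "z - C = (1 - u - u * k) *\<^sub>R (p - C)" .
  let ?c = "1 - u - u * k"
  have "?c \<noteq> 0" using z assms(5) by auto
  then consider "?c > 0" | "?c < 0" by linarith
  then show thesis
  proof cases
    case 1
    then show ?thesis using z that by blast
  next
    case 2
    have "z - C = (- ?c / k) *\<^sub>R (q - C)" unfolding z k(2) scaleR_scaleR using k(1) by simp
    moreover have "- ?c / k > 0" using 2 k(1) by (simp add: divide_pos_pos)
    ultimately show ?thesis using that by blast
  qed
qed

text \<open>
  A chord through the centre consists of two rays from the centre, and each of them meets the
  boundary at most once. Among three points of the boundary two are therefore equal.
\<close>

lemma chord_meets_boundary_twice:
  assumes reg: "regular_polygon n C v"
    and C: "C \<in> closed_segment p q" "p \<noteq> C" "q \<noteq> C"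
    and X: "X \<subseteq> closed_segment p q \<inter> polygon_boundary n v"
    and mem: "y \<in> X" "y' \<in> X" "z \<in> X" and "y \<noteq> y'"
  shows "z = y \<or> z = y'"
proof -
  have ray: "\<exists>s>0. \<exists>r\<in>{p, q}. b - C = s *\<^sub>R (r - C)" if "b \<in> X" for b
  proof -
    have "b \<in> closed_segment p q" "b \<noteq> C"
      using that X centre_notin_boundary[OF reg] by auto
    from chord_point_on_ray[OF C this] show ?thesis by metis
  qed
  have same: "b = b'"
    if "b \<in> X" "b' \<in> X" "s > 0" "s' > 0" "b - C = s *\<^sub>R (r - C)" "b' - C = s' *\<^sub>R (r - C)"
    for b b' s s' r
  proof -
    have e: "b - C = (s / s') *\<^sub>R (b' - C)" using that by simp
    have "s / s' = 1" using boundary_meets_ray_once[OF reg _ _ e] that X by auto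
    with e show ?thesis by simp
  qed
  obtain s1 r1 where 1: "s1 > 0" "r1 \<in> {p, q}" "y - C = s1 *\<^sub>R (r1 - C)"
    using ray[OF mem(1)] by blast
  obtain s2 r2 where 2: "s2 > 0" "r2 \<in> {p, q}" "y' - C = s2 *\<^sub>R (r2 - C)"
    using ray[OF mem(2)] by blast
  obtain s3 r3 where 3: "s3 > 0" "r3 \<in> {p, q}" "z - C = s3 *\<^sub>R (r3 - C)"
    using ray[OF mem(3)] by blast
  consider "r1 = r2" | "r3 = r1" | "r3 = r2" using 1(2) 2(2) 3(2) by blast
  then show ?thesis
  proof cases
    case 1
    then have "y = y'" using same[OF mem(1,2)] \<open>s1 > 0\<close> 2 \<open>y - C = _\<close> by simp
    with \<open>y \<noteq> y'\<close> show ?thesis by simp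
  next
    case 2
    then show ?thesis using same[OF mem(3,1)] 1 3 by simp
  next
    case 3
    then show ?thesis using same[OF mem(3,2)] 2 \<open>s3 > 0\<close> \<open>z - C = _\<close> by simp
  qed
qed

text \<open>
  A point on edge \<open>i\<close> has height 1, the maximum. It can only lie on another edge if every
  vertex of that edge with positive weight has height 1, too. Only the two ends of edge \<open>i\<close> have this
  height, and for \<open>n \<ge> 3\<close> no other edge joins them. Assigning to every edge its first vertex but not
  its last one leaves the first vertex of edge \<open>i + 1\<close> as the only exception.
\<close>

lemma edge_meets_edge:
  assumes reg: "regular_polygon n C v" and d: "d < n"
    and z: "z \<in> closed_segment (v i) (v (i + 1))"
    and z': "z = v (i + d) \<or> z \<in> open_segment (v (i + d)) (v (i + (d + 1)))"
  shows "d = 0 \<or> d = 1 \<and> z = v (i + 1)"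
proof (rule ccontr)
  assume neg: "\<not> ?thesis"
  let ?H = "edge_height C v i"
  have n: "n \<ge> 3" using reg by (simp add: regular_polygon_def)
  have vertex: "?H (v j) \<le> 1" for j by (rule edge_height_vertex_le[OF reg])
  have far: "2 \<le> e \<Longrightarrow> e < n \<Longrightarrow> ?H (v (i + e)) < 1" for e
    by (rule edge_height_far_vertex[OF reg])
  have "?H z < 1"
  proof (cases "z = v (i + d)")
    case True
    then have "d \<noteq> 0" "d \<noteq> 1" using neg by auto
    then have "2 \<le> d" by simp
    then show ?thesis using True far d by blast
  next
    case False
    then obtain u where u: "z = (1 - u) *\<^sub>R v (i + d) + u *\<^sub>R v (i + (d + 1))" "0 < u" "u < 1"
      using z' by (auto simp: in_segment)
    have "?H (v (i + d)) < 1 \<or> ?H (v (i + (d + 1))) < 1"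
    proof (cases "d = 1")
      case True
      then show ?thesis using far[of 2] n by simp
    next
      case False
      then show ?thesis using far[of d] d neg by force
    qed
    then have "(1 - u) * ?H (v (i + d)) + u * ?H (v (i + (d + 1))) < 1"
      using u vertex[of "i + d"] vertex[of "i + (d + 1)"]
      by (smt (verit) mult_left_le mult_less_cancel_left2)
    then show ?thesis unfolding u(1) edge_height_convex by (simp add: algebra_simps)
  qed
  then show False using edge_height_on_edge[OF reg z] by simp
qed

section \<open>Two homothetic polygons\<close>

text \<open>
  The centres agree, so the polygons differ by multiplication with a complex number, except that
  they might be traversed in opposite directions. Comparing the first two edges shows that the
  rotations from one vertex to the next differ by a positive real factor, which must be 1.
\<close>

lemma polygon_pair_homothetic:
  assumes "polygon_pair n C v"
  obtains k :: real where "k > 0" "k \<noteq> 1" "\<forall>i. v 2 i - C = k *\<^sub>R (v 1 i - C)"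
proof -
  have reg: "regular_polygon n C (v 1)" "regular_polygon n C (v 2)"
    and dist: "dist C (v 1 0) \<noteq> dist C (v 2 0)"
    and edges: "\<And>i. \<exists>k::real. k > 0 \<and> v 2 (i + 1) - v 2 i = k *\<^sub>R (v 1 (i + 1) - v 1 i)"
    using assms unfolding polygon_pair_def by blast+
  obtain a w where a: "a \<noteq> 0" and w: "w \<in> {cis (2 * pi / real n), cis (- (2 * pi / real n))}"
    and v: "\<And>i. v 1 i = C + a * w ^ i" and n: "n \<ge> 3"
    using reg(1) unfolding regular_polygon_def by blast
  obtain a' w' where w': "w' \<in> {cis (2 * pi / real n), cis (- (2 * pi / real n))}"
    and v': "\<And>i. v 2 i = C + a' * w' ^ i"
    using reg(2) unfolding regular_polygon_def by blast
  have norm: "cmod w = 1" "cmod w' = 1" using w w' by auto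
  have "sin (2 * pi / real n) > 0" using n by (intro sin_gt_zero) (auto simp: field_simps)
  then have "Im w \<noteq> 0" using w by auto
  then have w1: "w \<noteq> 1" by auto
  obtain k where k: "k > 0" "a' * (w' - 1) = of_real k * (a * (w - 1))"
    using edges[of 0] unfolding v v' by (auto simp: scaleR_conv_of_real algebra_simps)
  obtain l where l: "l > 0" "w' * (a' * (w' - 1)) = of_real l * (w * (a * (w - 1)))"
    using edges[of 1] unfolding v v'
    by (auto simp: scaleR_conv_of_real algebra_simps power2_eq_square)
  have kl: "of_real k * w' = of_real l * w"
    using l(2) a w1 unfolding k(2) by (auto simp: mult.commute)
  then have "cmod (of_real k * w') = cmod (of_real l * w)" by simp
  then have "k = l" using norm k l by (simp add: norm_mult)
  with kl k have ww: "w' = w" by auto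
  with k(2) w1 have aa: "a' = of_real k * a" by auto
  have hom: "v 2 i - C = k *\<^sub>R (v 1 i - C)" for i
    unfolding v v' ww aa by (simp add: scaleR_conv_of_real)
  have "k \<noteq> 1" using hom[of 0] dist by (auto simp: dist_norm)
  with k(1) hom that show thesis by blast
qed

lemma polygon_pair_boundaries_disjoint:
  assumes "polygon_pair n C v"
  shows "polygon_boundary n (v 1) \<inter> polygon_boundary n (v 2) = {}"
proof -
  obtain k where k: "k > 0" "k \<noteq> 1" "\<forall>i. v 2 i - C = k *\<^sub>R (v 1 i - C)"
    using polygon_pair_homothetic[OF assms] .
  have reg: "regular_polygon n C (v 1)" using assms by (simp add: polygon_pair_def)
  have False if z: "z \<in> polygon_boundary n (v 1)" "z \<in> polygon_boundary n (v 2)" for z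
  proof -
    obtain i u where i: "i < n" and z2: "z = (1 - u) *\<^sub>R v 2 i + u *\<^sub>R v 2 (i + 1)"
      and u: "0 \<le> u" "u \<le> 1"
      using z(2) unfolding polygon_boundary_def closed_segment_def by blast
    let ?y = "(1 - u) *\<^sub>R v 1 i + u *\<^sub>R v 1 (i + 1)"
    have y: "?y \<in> polygon_boundary n (v 1)"
      using i u unfolding polygon_boundary_def closed_segment_def by blast
    have "z - C = (1 - u) *\<^sub>R (v 2 i - C) + u *\<^sub>R (v 2 (i + 1) - C)"
      unfolding z2 by (simp add: algebra_simps)
    also have "\<dots> = k *\<^sub>R (?y - C)" by (simp add: k(3)[rule_format] algebra_simps)
    finally show False using boundary_meets_ray_once[OF reg z(1) y _ k(1)] k(2) by blast
  qed
  then show ?thesis by blast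
qed

section \<open>Points marked on the two polygons\<close>

locale marked_polygon_pair =
  fixes n :: nat and C :: complex and v P :: "nat \<Rightarrow> nat \<Rightarrow> complex"
  assumes polygons: "polygon_pair n C v" and points: "polygon_points n C v P"
begin

definition marks :: "complex set" where
  "marks = {C} \<union> {P t m | t m. t \<in> {1, 2} \<and> m \<in> {1..4 * n}}"

lemma regular: "t \<in> {1, 2} \<Longrightarrow> regular_polygon n C (v t)"
  using polygons by (auto simp: polygon_pair_def)

lemma n_ge_3: "n \<ge> 3"
  using regular[of 1] by (simp add: regular_polygon_def)

lemma larger_cases: "larger C v \<in> {1, 2}"
  by (simp add: larger_def)

lemma mark_mod:
  assumes t: "t \<in> {1, 2}"
  shows "P t (m mod (4 * n)) = P t m"
proof -
  have step: "P t (m + 4 * n) = P t m" for m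
    using points t unfolding polygon_points_def by blast
  have "P t (m + 4 * n * q) = P t m" for m q
  proof (induction q)
    case (Suc q)
    then show ?case using step[of "m + 4 * n * q"] by (simp add: algebra_simps)
  qed simp
  from this[of "m mod (4 * n)" "m div (4 * n)"] show ?thesis by simp
qed

lemma mark_cong:
  assumes "t \<in> {1, 2}" "m mod (4 * n) = m' mod (4 * n)"
  shows "P t m = P t m'"
  using mark_mod[OF assms(1)] assms(2) by metis

text \<open>
  Any \<open>4 * n\<close> successive indices reach all marks, so marks can be counted from the start of
  the edge under consideration.
\<close>

lemma mark_from:
  assumes t: "t \<in> {1, 2}"
  obtains r where "r < 4 * n" "P t m = P t (s + r)"
proof
  \<comment> \<open>The residue of \<open>m - s\<close>.\<close>
  let ?r = "(m + (4 * n - 1) * s) mod (4 * n)"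
  show "?r < 4 * n" using n_ge_3 by simp
  have "s + (4 * n - 1) * s = 4 * n * s" using n_ge_3 by (simp add: diff_mult_distrib)
  then have "s + (m + (4 * n - 1) * s) = m + 4 * n * s" by linarith
  moreover have "(s + ?r) mod (4 * n) = (s + (m + (4 * n - 1) * s)) mod (4 * n)"
    by (rule mod_add_right_eq)
  ultimately have "(s + ?r) mod (4 * n) = m mod (4 * n)" by (metis mod_mult_self2)
  then show "P t m = P t (s + ?r)" by (intro mark_cong[OF t]) simp
qed

lemma mark_in_marks:
  assumes t: "t \<in> {1, 2}"
  shows "P t m \<in> marks"
proof -
  obtain r where "r < 4 * n" "P t m = P t (1 + r)" using mark_from[OF t] .
  then show ?thesis using t unfolding marks_def by (intro UnI2) force
qed

lemma shifted_edge_index: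
  "(4 * (i mod n) + e) mod (4 * n) = (4 * i + e) mod (4 * n)"
  by (metis mod_add_left_eq mult_mod_right)

lemma mark_vertex:
  assumes t: "t \<in> {1, 2}"
  shows "P t (4 * i + 1) = v t i"
proof -
  have i: "i mod n + 1 \<in> {1..n}" using n_ge_3 by (simp add: Suc_leI)
  have "\<forall>i\<in>{1..n}. P t (4 * (i - 1) + 1) = v t (i - 1)"
    using points t unfolding polygon_points_def by blast
  from this[rule_format, OF i] have "P t (4 * (i mod n) + 1) = v t (i mod n)" by simp
  moreover have "P t (4 * (i mod n) + 1) = P t (4 * i + 1)"
    by (rule mark_cong[OF t shifted_edge_index])
  ultimately show ?thesis using regular_polygon_mod[OF regular[OF t]] by simp
qed

lemma mark_intermediate:
  assumes t: "t \<in> {1, 2}" and e: "e \<in> {1, 2, 3}"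
  shows "P t (4 * i + 1 + e) \<in> open_segment (v t i) (v t (i + 1))"
proof -
  have i: "i mod n + 1 \<in> {1..n}" using n_ge_3 by (simp add: Suc_leI)
  have "\<forall>i\<in>{1..n}. \<forall>j\<in>{1, 2, 3}.
        P t (4 * (i - 1) + j + 1)
          \<in> open_segment (P t (4 * (i - 1) + j)) (P t (4 * (i - 1) + 5))"
    using points t unfolding polygon_points_def by blast
  from this[rule_format, OF i]
  have "P t (4 * (i mod n) + (j + 1))
      \<in> open_segment (P t (4 * (i mod n) + j)) (P t (4 * (i mod n) + 5))"
    if "j \<in> {1, 2, 3}" for j
    using that by (simp add: add.assoc)
  then have step: "P t (4 * i + (j + 1)) \<in> open_segment (P t (4 * i + j)) (P t (4 * i + 5))"
    if "j \<in> {1, 2, 3}" for j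
    using that by (simp only: mark_cong[OF t shifted_edge_index])
  have ends: "P t (4 * i + 1) = v t i" "P t (4 * i + 5) = v t (i + 1)"
    using mark_vertex[OF t, of i] mark_vertex[OF t, of "i + 1"] by (simp_all add: algebra_simps)
  \<comment> \<open>Each mark is only known to lie between its predecessor and the end of the edge.\<close>
  have shrink: "c \<in> open_segment a d"
    if "b \<in> open_segment a d" "c \<in> open_segment b d" for a b c d :: complex
    using that subset_open_segment[of b d a d] open_closed_segment[of b a d] by auto
  have 1: "P t (4 * i + 2) \<in> open_segment (v t i) (v t (i + 1))"
    using step[of 1] ends by simp
  have 2: "P t (4 * i + 3) \<in> open_segment (v t i) (v t (i + 1))"
    using shrink[OF 1] step[of 2] ends by simp
  have 3: "P t (4 * i + 4) \<in> open_segment (v t i) (v t (i + 1))"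
    using shrink[OF 2] step[of 3] ends by simp
  have shift: "4 * i + 1 + 1 = 4 * i + 2" "4 * i + 1 + 2 = 4 * i + 3" "4 * i + 1 + 3 = 4 * i + 4"
    by simp_all
  consider "e = 1" | "e = 2" | "e = 3" using e by blast
  then show ?thesis using 1 2 3 by cases (simp_all only: shift)
qed

lemma mark_position:
  assumes t: "t \<in> {1, 2}" and e: "e < 4"
  shows "P t (4 * i + 1 + e) = v t i \<or> P t (4 * i + 1 + e) \<in> open_segment (v t i) (v t (i + 1))"
proof (cases "e = 0")
  case True
  then show ?thesis using mark_vertex[OF t] by simp
next
  case False
  then have "e \<in> {1, 2, 3}" using e by auto
  then show ?thesis using mark_intermediate[OF t] by blast
qed

lemma mark_on_boundary:
  assumes t: "t \<in> {1, 2}"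
  shows "P t m \<in> polygon_boundary n (v t)"
proof -
  obtain r where r: "P t m = P t (1 + r)" using mark_from[OF t] .
  have "r = 4 * (r div 4) + r mod 4" by simp
  then have "P t m = P t (4 * (r div 4) + 1 + r mod 4)" using r by (metis add.assoc add.commute)
  then have "P t m \<in> closed_segment (v t (r div 4)) (v t (r div 4 + 1))"
    using mark_position[OF t, of "r mod 4" "r div 4"] by (auto simp: open_segment_def)
  then show ?thesis using edge_subset_boundary[OF regular[OF t]] by blast
qed

lemma mark_neq_centre: "t \<in> {1, 2} \<Longrightarrow> P t m \<noteq> C"
  using mark_on_boundary centre_notin_boundary[OF regular] by metis

lemma marks_on_boundary:
  assumes t: "t \<in> {1, 2}"
  shows "marks \<inter> polygon_boundary n (v t) = range (P t)"
proof
  show "range (P t) \<subseteq> marks \<inter> polygon_boundary n (v t)"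
    using mark_in_marks[OF t] mark_on_boundary[OF t] by auto
  show "marks \<inter> polygon_boundary n (v t) \<subseteq> range (P t)"
  proof
    fix z assume z: "z \<in> marks \<inter> polygon_boundary n (v t)"
    then have "z \<noteq> C" using centre_notin_boundary[OF regular[OF t]] by auto
    then obtain t' m where t': "t' \<in> {1, 2}" "z = P t' m"
      using z unfolding marks_def by auto
    then have "z \<in> polygon_boundary n (v t')" using mark_on_boundary by simp
    then have "t' = t"
      using z t t'(1) polygon_pair_boundaries_disjoint[OF polygons] by auto
    with t' show "z \<in> range (P t)" by simp
  qed
qed

text \<open>
  Marks of the other polygon are excluded because the boundaries are disjoint. A mark of the same
  polygon is \<open>r = 4 * d + e\<close> steps away from the start of edge \<open>i\<close>, which puts it on edge \<open>i + d\<close>.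
\<close>

lemma marks_on_edge:
  assumes t: "t \<in> {1, 2}"
  shows "marks \<inter> closed_segment (v t i) (v t (i + 1)) = (\<lambda>e. P t (4 * i + 1 + e)) ` {..4}"
    (is "?L = ?R")
proof
  show "?R \<subseteq> ?L"
  proof
    fix z assume "z \<in> ?R"
    then obtain e where e: "e \<le> 4" "z = P t (4 * i + 1 + e)" by auto
    have "z \<in> closed_segment (v t i) (v t (i + 1))"
    proof (cases "e = 4")
      case True
      have "z = v t (i + 1)"
        using e(2) mark_vertex[OF t, of "i + 1"] unfolding True by (simp add: algebra_simps)
      then show ?thesis by simp
    next
      case False
      then show ?thesis using mark_position[OF t, of e i] e by (auto simp: open_segment_def)
    qed
    then show "z \<in> ?L" using mark_in_marks[OF t] e(2) by simp
  qed
  show "?L \<subseteq> ?R"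
  proof
    fix z assume z: "z \<in> ?L"
    then have "z \<in> range (P t)"
      using marks_on_boundary[OF t] edge_subset_boundary[OF regular[OF t]] by blast
    then obtain r where r: "r < 4 * n" "z = P t (4 * i + 1 + r)"
      using mark_from[OF t] by (metis rangeE)
    define d e where "d = r div 4" and "e = r mod 4"
    have de: "r = 4 * d + e" "e < 4" by (simp_all add: d_def e_def)
    have d: "d < n" using r(1) by (simp add: d_def)
    have zde: "z = P t (4 * (i + d) + 1 + e)" using r(2) de(1) by (simp add: algebra_simps)
    have "z = v t (i + d) \<or> z \<in> open_segment (v t (i + d)) (v t (i + d + 1))"
      using mark_position[OF t de(2), of "i + d"] zde by simp
    then have "d = 0 \<or> d = 1 \<and> z = v t (i + 1)"
      using z by (intro edge_meets_edge[OF regular[OF t] d]) auto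
    then consider "d = 0" | "z = v t (i + 1)" by blast
    then show "z \<in> ?R"
    proof cases
      case 1
      then show ?thesis using zde de(2) by auto
    next
      case 2
      then have "z = P t (4 * i + 1 + 4)"
        using mark_vertex[OF t, of "i + 1"] by (simp add: algebra_simps)
      then show ?thesis by blast
    qed
  qed
qed

lemma spoke:
  "{P 1 m, P 2 m, C, P 1 (m + 2 * n), P 2 (m + 2 * n)}
     \<subseteq> closed_segment (P (larger C v) m) (P (larger C v) (m + 2 * n))"
  using points unfolding polygon_points_def by blast

text \<open>
  A mark of polygon \<open>t\<close> on the spoke would be a third point on the boundary of that polygon besides
  \<open>P t m\<close> and \<open>P t (m + 2 * n)\<close>. The spoke is treated as a whole because \<open>P 1 m\<close> and \<open>P 2 m\<close> might lie
  on opposite sides of the centre.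
\<close>

lemma marks_on_spoke:
  assumes distinct: "\<And>t. t \<in> {1, 2} \<Longrightarrow> P t m \<noteq> P t (m + 2 * n)"
  shows "marks \<inter> closed_segment (P (larger C v) m) (P (larger C v) (m + 2 * n))
    = {P 1 m, P 2 m, C, P 1 (m + 2 * n), P 2 (m + 2 * n)}"
    (is "?L = ?R")
proof
  let ?p = "P (larger C v) m" and ?q = "P (larger C v) (m + 2 * n)"
  have C: "C \<in> closed_segment ?p ?q" "?p \<noteq> C" "?q \<noteq> C"
    using spoke mark_neq_centre[OF larger_cases] by auto
  show "?R \<subseteq> ?L" using spoke mark_in_marks[of 1] mark_in_marks[of 2] by (auto simp: marks_def)
  show "?L \<subseteq> ?R"
  proof
    fix z assume z: "z \<in> ?L"
    show "z \<in> ?R"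
    proof (cases "z = C")
      case False
      then obtain t k where t: "t \<in> {1, 2}" and zt: "z = P t k"
        using z unfolding marks_def by auto
      let ?X = "closed_segment ?p ?q \<inter> polygon_boundary n (v t)"
      have "P t m \<in> ?X" "P t (m + 2 * n) \<in> ?X" "z \<in> ?X"
        using t zt z spoke[of m] mark_on_boundary[OF t] by auto
      from chord_meets_boundary_twice[OF regular[OF t] C subset_refl this distinct[OF t]] t
      show ?thesis by auto
    qed simp
  qed
qed

end

section \<open>Labellings\<close>

text \<open>
  The conditions on positions \<open>(i, j)\<close> are expressed by indices modulo \<open>4 * n\<close>, so that they can be
  applied to \<open>m + 2 * n\<close> and across the end of an edge without reducing the index.
\<close>

locale complementary_labelling = marked_polygon_pair +
  fixes label :: "complex \<Rightarrow> nat"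
  assumes label_range: "t \<in> {1, 2} \<Longrightarrow> label (P t m) \<in> {1..8 * n + 1}"
    and label_centre: "label C = 4 * n + 1"
    and label_neq_centre: "t \<in> {1, 2} \<Longrightarrow> label (P t m) \<noteq> 4 * n + 1"
    and label_complement: "label (P 1 m) + label (P 2 m) = 2 * (4 * n + 1)"
    and label_distinct: "t \<in> {1, 2} \<Longrightarrow> m mod (4 * n) \<noteq> m' mod (4 * n) \<Longrightarrow>
      label (P t m) \<noteq> label (P t m')"
    and label_no_complement: "t \<in> {1, 2} \<Longrightarrow> m mod (4 * n) \<noteq> m' mod (4 * n) \<Longrightarrow>
      label (P t m) + label (P t m') \<noteq> 2 * (4 * n + 1)"
    and edge_sum: "i < n \<Longrightarrow> (\<Sum>e\<le>4. label (P 1 (4 * i + 1 + e))) = 5 * (4 * n + 1)"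
begin

text \<open>
  If \<open>P 1 m\<close> had the label of \<open>P 2 m'\<close>, it would be complementary to the label of \<open>P 1 m'\<close>. This is
  excluded for different positions, and for \<open>m = m'\<close> modulo \<open>4 * n\<close> it forces the label of the centre.
\<close>

lemma label_cross_distinct: "label (P 1 m) \<noteq> label (P 2 m')"
proof
  assume eq: "label (P 1 m) = label (P 2 m')"
  show False
  proof (cases "m mod (4 * n) = m' mod (4 * n)")
    case True
    then have "label (P 1 m) = label (P 2 m)" using eq mark_cong[of 2 m' m] by simp
    then have "label (P 1 m) = 4 * n + 1" using label_complement[of m] by simp
    then show False using label_neq_centre[of 1 m] by simp
  next
    case False
    then show False using eq label_no_complement[of 1 m m'] label_complement[of m'] by simp
  qed
qed

lemma inj_on_label: "inj_on label marks"
proof (rule inj_onI)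
  fix y z assume yz: "y \<in> marks" "z \<in> marks" and eq: "label y = label z"
  have mem: "b = C \<or> (\<exists>m. b = P 1 m) \<or> (\<exists>m. b = P 2 m)" if "b \<in> marks" for b
    using that unfolding marks_def by auto
  have same: "P t m = P t m'" if "t \<in> {1, 2}" "label (P t m) = label (P t m')" for t m m'
    using that label_distinct mark_cong by metis
  have "label (P 1 m) \<noteq> label C" "label (P 2 m) \<noteq> label C" for m
    using label_neq_centre[of 1] label_neq_centre[of 2] label_centre by auto
  then show "y = z"
    using mem[OF yz(1)] mem[OF yz(2)] eq same[of 1] same[of 2] label_cross_distinct
    by (elim disjE exE) (simp_all, metis+)
qed

lemma inj_on_mark:
  assumes t: "t \<in> {1, 2}" and inj: "inj_on (\<lambda>m. m mod (4 * n)) I"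
  shows "inj_on (P t) I"
  using inj label_distinct[OF t] unfolding inj_on_def by metis

lemma card_marks: "card marks = 8 * n + 1"
proof -
  let ?I = "{1..4 * n}"
  have "inj_on (\<lambda>m. m mod (4 * n)) ?I"
  proof (rule inj_onI)
    fix m m' assume "m \<in> ?I" "m' \<in> ?I" "m mod (4 * n) = m' mod (4 * n)"
    then show "m = m'" by (cases "m = 4 * n"; cases "m' = 4 * n") auto
  qed
  then have card: "card (P t ` ?I) = 4 * n" if "t \<in> {1, 2}" for t
    using inj_on_mark[OF that] card_image by fastforce
  have marks: "marks = insert C (P 1 ` ?I \<union> P 2 ` ?I)"
    unfolding marks_def by blast
  have "P 1 m \<noteq> P 2 m'" for m m' using label_cross_distinct by metis
  then have "P 1 ` ?I \<inter> P 2 ` ?I = {}" by blast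
  then have "card (P 1 ` ?I \<union> P 2 ` ?I) = 8 * n"
    using card[of 1] card[of 2] by (subst card_Un_disjoint) auto
  moreover have "C \<notin> P 1 ` ?I \<union> P 2 ` ?I"
    using mark_neq_centre[of 1] mark_neq_centre[of 2] by force
  ultimately show ?thesis unfolding marks by (subst card_insert_disjoint) auto
qed

lemma bij_betw_label: "bij_betw label marks {1..8 * n + 1}"
proof -
  have "label ` marks \<subseteq> {1..8 * n + 1}"
    using label_range label_centre unfolding marks_def by auto
  moreover have "card (label ` marks) = card {1..8 * n + 1}"
    using card_image[OF inj_on_label] card_marks by simp
  ultimately have "label ` marks = {1..8 * n + 1}" by (intro card_subset_eq) auto
  with inj_on_label show ?thesis by (simp add: bij_betw_def)
qed

lemma inj_on_edge_marks:
  assumes t: "t \<in> {1, 2}"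
  shows "inj_on (\<lambda>e. P t (4 * i + 1 + e)) {..4}"
proof (rule inj_onI)
  fix e e' :: nat
  assume e: "e \<in> {..4}" "e' \<in> {..4}" and eq: "P t (4 * i + 1 + e) = P t (4 * i + 1 + e')"
  \<comment> \<open>The five indices of an edge stay different modulo \<open>4 * n\<close>, because \<open>4 * n > 4\<close>.\<close>
  have no_wrap: "\<not> e < e'"
    if "e' \<le> 4" "(4 * i + 1 + e) mod (4 * n) = (4 * i + 1 + e') mod (4 * n)" for e e'
  proof
    assume "e < e'"
    then have "4 * n dvd (4 * i + 1 + e') - (4 * i + 1 + e)"
      using that(2) by (metis add_left_mono less_imp_le mod_eq_dvd_iff_nat)
    then show False using \<open>e < e'\<close> that(1) n_ge_3 by (auto dest!: dvd_imp_le)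
  qed
  from eq have "(4 * i + 1 + e) mod (4 * n) = (4 * i + 1 + e') mod (4 * n)"
    using label_distinct[OF t] by metis
  with no_wrap[of e' e] no_wrap[of e e'] e show "e = e'" by auto
qed

lemma card_marks_on_edge:
  assumes t: "t \<in> {1, 2}"
  shows "card (marks \<inter> closed_segment (v t i) (v t (i + 1))) = 5"
  unfolding marks_on_edge[OF t] using card_image[OF inj_on_edge_marks[OF t]] by simp

lemma card_marks_inside_edge:
  assumes t: "t \<in> {1, 2}"
  shows "card (marks \<inter> open_segment (v t i) (v t (i + 1))) = 3"
proof -
  have vertices: "v t i = P t (4 * i + 1 + 0)" "v t (i + 1) = P t (4 * i + 1 + 4)"
    using mark_vertex[OF t, of i] mark_vertex[OF t, of "i + 1"] by (simp_all add: algebra_simps)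
  then have "v t i \<noteq> v t (i + 1)"
    using inj_onD[OF inj_on_edge_marks[OF t], of i 0 4] by auto
  moreover have "{v t i, v t (i + 1)} \<subseteq> marks \<inter> closed_segment (v t i) (v t (i + 1))"
    using vertices mark_in_marks[OF t] by simp
  moreover have "marks \<inter> open_segment (v t i) (v t (i + 1))
      = marks \<inter> closed_segment (v t i) (v t (i + 1)) - {v t i, v t (i + 1)}"
    by (auto simp: open_segment_def)
  ultimately show ?thesis using card_marks_on_edge[OF t, of i] by (simp add: card_Diff_subset)
qed

text \<open>
  For the second polygon, the edge sum follows by pairing each mark with the corresponding one on the
  first polygon: the five pairs add up to \<open>10 * (4 * n + 1)\<close>.
\<close>

lemma label_sum_on_edge:
  assumes t: "t \<in> {1, 2}" and i: "i < n"
  shows "(\<Sum>z \<in> marks \<inter> closed_segment (v t i) (v t (i + 1)). label z) = 5 * (4 * n + 1)"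
proof -
  let ?s = "\<lambda>t. \<Sum>e\<le>4. label (P t (4 * i + 1 + e))"
  have "?s 1 + ?s 2 = (\<Sum>e\<le>(4::nat). 2 * (4 * n + 1))"
    unfolding sum.distrib[symmetric] label_complement ..
  then have "?s 1 = 5 * (4 * n + 1)" "?s 2 = 5 * (4 * n + 1)"
    using edge_sum[OF i] by simp_all
  then have "?s t = 5 * (4 * n + 1)" using t by auto
  then show ?thesis
    unfolding marks_on_edge[OF t] sum.reindex[OF inj_on_edge_marks[OF t]] comp_def .
qed

lemma opposite_marks_distinct:
  assumes t: "t \<in> {1, 2}"
  shows "P t m \<noteq> P t (m + 2 * n)"
proof -
  have "m mod (4 * n) \<noteq> (m + 2 * n) mod (4 * n)"
  proof
    assume "m mod (4 * n) = (m + 2 * n) mod (4 * n)"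
    then have "4 * n dvd (m + 2 * n) - m" by (metis le_add1 mod_eq_dvd_iff_nat)
    then show False using n_ge_3 by (auto dest!: dvd_imp_le)
  qed
  then show ?thesis using label_distinct[OF t] by metis
qed

lemma five_on_spoke:
  defines "B m \<equiv> {P 1 m, P 2 m, C, P 1 (m + 2 * n), P 2 (m + 2 * n)}"
  shows "card (B m) = 5" "(\<Sum>z \<in> B m. label z) = 5 * (4 * n + 1)"
proof -
  have "P 1 k \<noteq> P 2 l" for k l using label_cross_distinct by metis
  then have "distinct [P 1 m, P 2 m, C, P 1 (m + 2 * n), P 2 (m + 2 * n)]"
    using opposite_marks_distinct[of 1 m] opposite_marks_distinct[of 2 m]
      mark_neq_centre[of 1] mark_neq_centre[of 2]
    by (simp, metis)
  then show "card (B m) = 5" "(\<Sum>z \<in> B m. label z) = 5 * (4 * n + 1)"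
    using label_complement[of m] label_complement[of "m + 2 * n"] label_centre
    by (simp_all add: B_def)
qed

text \<open>
  A chord through the centre that starts at a mark of the larger polygon is a spoke, since its
  other end is determined by the first one.
\<close>

lemma marks_on_chord:
  assumes p: "p \<in> marks \<inter> polygon_boundary n (v (larger C v))"
    and q: "q \<in> polygon_boundary n (v (larger C v))"
    and C: "C \<in> closed_segment p q"
  obtains m where "marks \<inter> closed_segment p q
    = {P 1 m, P 2 m, C, P 1 (m + 2 * n), P 2 (m + 2 * n)}"
proof -
  let ?L = "larger C v"
  obtain m where m: "p = P ?L m" using p marks_on_boundary[OF larger_cases] by auto
  have "q = P ?L (m + 2 * n)"
  proof (rule boundary_opposite_unique[OF regular[OF larger_cases] _ q _ C])
    show "p \<in> polygon_boundary n (v ?L)" using p by simp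
    show "P ?L (m + 2 * n) \<in> polygon_boundary n (v ?L)" by (rule mark_on_boundary[OF larger_cases])
    show "C \<in> closed_segment p (P ?L (m + 2 * n))" using spoke[of m] m by auto
  qed
  with m marks_on_spoke[OF opposite_marks_distinct] that show thesis by simp
qed

lemma magic: "magic_polygon4 n C v marks label"
  unfolding magic_polygon4_def
proof (intro conjI ballI allI impI exI[of _ "5 * (4 * n + 1)"])
  show "polygon_pair n C v" by (rule polygons)
  show "card marks = 8 * n + 1" by (rule card_marks)
  show "bij_betw label marks {1..8 * n + 1}" by (rule bij_betw_label)
  show "C \<in> marks" by (simp add: marks_def)
  show "marks \<subseteq> {C} \<union> polygon_boundary n (v 1) \<union> polygon_boundary n (v 2)"
    unfolding marks_def using mark_on_boundary by auto
next
  fix t i assume t: "t \<in> {1::nat, 2}" and i: "i < n"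
  show "v t i \<in> marks" using mark_in_marks[OF t, of "4 * i + 1"] mark_vertex[OF t, of i] by simp
  show "card (marks \<inter> open_segment (v t i) (v t (i + 1))) = 3"
    by (rule card_marks_inside_edge[OF t])
  show "card (marks \<inter> closed_segment (v t i) (v t (i + 1))) = 5"
    by (rule card_marks_on_edge[OF t])
  show "(\<Sum>z \<in> marks \<inter> closed_segment (v t i) (v t (i + 1)). label z) = 5 * (4 * n + 1)"
    by (rule label_sum_on_edge[OF t i])
next
  fix p q
  assume "p \<in> marks \<inter> polygon_boundary n (v (larger C v))"
    "q \<in> polygon_boundary n (v (larger C v))" "C \<in> closed_segment p q"
  then obtain m where m: "marks \<inter> closed_segment p q
      = {P 1 m, P 2 m, C, P 1 (m + 2 * n), P 2 (m + 2 * n)}"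
    by (rule marks_on_chord)
  show "card (marks \<inter> closed_segment p q) = 5"
    "(\<Sum>z \<in> marks \<inter> closed_segment p q. label z) = 5 * (4 * n + 1)"
    unfolding m by (fact five_on_spoke)+
qed

end

text \<open>
  Indices modulo \<open>4 * n\<close> and positions \<open>(i, j)\<close>, with \<open>i\<close> and \<open>j\<close> counted from 1, describe the same
  points.
\<close>

lemma edge_position:
  fixes n m :: nat
  assumes "n > 0"
  obtains i j where "i \<in> {1..n}" "j \<in> {1..4}" "(4 * (i - 1) + j) mod (4 * n) = m mod (4 * n)"
proof
  \<comment> \<open>The residue of \<open>m - 1\<close>, since positions are counted from 1.\<close>
  define k where "k = (m + 4 * n - 1) mod (4 * n)"
  have "k < 4 * n" using assms by (simp add: k_def)
  then show "k div 4 + 1 \<in> {1..n}" by auto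
  show "k mod 4 + 1 \<in> {1..4}" by (auto simp: Suc_leI)
  have "4 * (k div 4 + 1 - 1) + (k mod 4 + 1) = k + 1" by simp
  moreover have "(k + 1) mod (4 * n) = (m + 4 * n - 1 + 1) mod (4 * n)"
    unfolding k_def by (rule mod_add_left_eq)
  moreover have "m + 4 * n - 1 + 1 = m + 4 * n" using assms by simp
  ultimately show "(4 * (k div 4 + 1 - 1) + (k mod 4 + 1)) mod (4 * n) = m mod (4 * n)" by simp
qed

theorem theorem2:
  fixes n :: nat and C :: complex
    and v P :: "nat \<Rightarrow> nat \<Rightarrow> complex"
    and label :: "complex \<Rightarrow> nat" and x :: "nat \<Rightarrow> nat \<Rightarrow> nat"
  assumes polygons: "polygon_pair n C v"
    and points: "polygon_points n C v P"
    and labels: "\<forall>t\<in>{1, 2}. \<forall>m. label (P t m) = x t m"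
    and i: "\<forall>t\<in>{1, 2}. \<forall>i\<in>{1..n}. \<forall>j\<in>{1..4}. x t (4 * (i - 1) + j) \<in> {1..8 * n + 1}"
    and ii: "label C = 4 * n + 1"
    and iii: "\<forall>i\<in>{1..n}. \<forall>j\<in>{1..4}.
      x 1 (4 * (i - 1) + j) + x 2 (4 * (i - 1) + j) = 2 * (4 * n + 1)"
    and iv: "\<forall>t\<in>{1, 2}. \<forall>i\<^sub>1\<in>{1..n}. \<forall>i\<^sub>2\<in>{1..n}. \<forall>j\<^sub>1\<in>{1..4}. \<forall>j\<^sub>2\<in>{1..4}.
      (i\<^sub>1, j\<^sub>1) \<noteq> (i\<^sub>2, j\<^sub>2) \<longrightarrow>
      x t (4 * (i\<^sub>1 - 1) + j\<^sub>1) + x t (4 * (i\<^sub>2 - 1) + j\<^sub>2) \<noteq> 2 * (4 * n + 1)"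
    and v: "\<forall>i\<in>{1..n}.
      x 1 (4 * (i - 1) + 1) + x 1 (4 * (i - 1) + 2) + x 1 (4 * (i - 1) + 3)
        + x 1 (4 * (i - 1) + 4) + x 1 (4 * (i - 1) + 5) = 5 * (4 * n + 1)"
    and distinct_on_polygon: "\<forall>t\<in>{1, 2}. \<forall>i\<^sub>1\<in>{1..n}. \<forall>i\<^sub>2\<in>{1..n}. \<forall>j\<^sub>1\<in>{1..4}. \<forall>j\<^sub>2\<in>{1..4}.
      (i\<^sub>1, j\<^sub>1) \<noteq> (i\<^sub>2, j\<^sub>2) \<longrightarrow>
      x t (4 * (i\<^sub>1 - 1) + j\<^sub>1) \<noteq> x t (4 * (i\<^sub>2 - 1) + j\<^sub>2)"
    and distinct_from_centre: "\<forall>t\<in>{1, 2}. \<forall>i\<in>{1..n}. \<forall>j\<in>{1..4}.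
      x t (4 * (i - 1) + j) \<noteq> 4 * n + 1"
  shows "magic_polygon4 n C v ({C} \<union> {P t m | t m. t \<in> {1, 2} \<and> m \<in> {1..4 * n}}) label"
proof -
  interpret marked_polygon_pair n C v P by unfold_locales (fact polygons points)+
  have x_cong: "x t m = x t m'" if "t \<in> {1, 2}" "m mod (4 * n) = m' mod (4 * n)" for t m m'
    using mark_cong[OF that] labels that(1) by metis
  have pos: "\<exists>i\<in>{1..n}. \<exists>j\<in>{1..4}. (4 * (i - 1) + j) mod (4 * n) = m mod (4 * n)
      \<and> x 1 m = x 1 (4 * (i - 1) + j) \<and> x 2 m = x 2 (4 * (i - 1) + j)" for m
  proof -
    obtain i j where "i \<in> {1..n}" "j \<in> {1..4}" "(4 * (i - 1) + j) mod (4 * n) = m mod (4 * n)"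
      using edge_position[of n m] n_ge_3 by auto
    then show ?thesis using x_cong[of 1 m] x_cong[of 2 m] by (metis insertCI)
  qed
  have label: "label (P t m) = x t m" if "t \<in> {1, 2}" for t m using labels that by blast
  interpret complementary_labelling n C v P label
  proof unfold_locales
    fix t m m' assume t: "t \<in> {1::nat, 2}"
    obtain i j where ij: "i \<in> {1..n}" "j \<in> {1..4}" "(4 * (i - 1) + j) mod (4 * n) = m mod (4 * n)"
      and x: "x t m = x t (4 * (i - 1) + j)" using pos[of m] t by auto
    show "label (P t m) \<in> {1..8 * n + 1}" unfolding label[OF t] x using assms(4) t ij by blast
    show "label (P t m) \<noteq> 4 * n + 1" unfolding label[OF t] x
      using distinct_from_centre t ij by blast
    assume ne: "m mod (4 * n) \<noteq> m' mod (4 * n)"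
    obtain i' j' where ij': "i' \<in> {1..n}" "j' \<in> {1..4}"
        "(4 * (i' - 1) + j') mod (4 * n) = m' mod (4 * n)"
      and x': "x t m' = x t (4 * (i' - 1) + j')" using pos[of m'] t by auto
    have "(i, j) \<noteq> (i', j')" using ne ij(3) ij'(3) by auto
    then show "label (P t m) \<noteq> label (P t m')"
      "label (P t m) + label (P t m') \<noteq> 2 * (4 * n + 1)"
      unfolding label[OF t] x x' using distinct_on_polygon iv t ij ij' by blast+
  next
    show "label C = 4 * n + 1" by (fact ii)
  next
    fix m
    obtain i j where "i \<in> {1..n}" "j \<in> {1..4}"
      "x 1 m = x 1 (4 * (i - 1) + j)" "x 2 m = x 2 (4 * (i - 1) + j)" using pos[of m] by blast
    then show "label (P 1 m) + label (P 2 m) = 2 * (4 * n + 1)"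
      using iii label[of 1] label[of 2] by simp
  next
    fix i assume "i < n"
    then have "i + 1 \<in> {1..n}" by simp
    from assms(8)[rule_format, OF this]
    show "(\<Sum>e\<le>4. label (P 1 (4 * i + 1 + e))) = 5 * (4 * n + 1)"
      by (simp add: label numeral_eq_Suc)
  qed
  show ?thesis using magic unfolding marks_def .
qed

end
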